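(* Let $W:\mathbb{R}^d\to\mathbb{R}\cup\{\infty\}$ be locally integrable, bounded from below and lower-semicontinuous with $W(\mathbf{x})=W(-\mathbf{x})$, and let $U:\mathbb{R}^d\to\mathbb{R}\cup\{\infty\}$ be locally integrable, bounded from below and lower-semicontinuous, with $\lim_{|\mathbf{x}|\to\infty}U(\mathbf{x})=U_\infty\in\mathbb{R}\cup\{\infty\}$. If $$\inf_{\rho\in\mathcal{M}(\mathbb{R}^d)}E_{W,U}[\rho]<\frac12\big(U_\infty+\inf U+\inf W\big),$$ then there exists a minimizer of $E_{W,U}$ in $\mathcal{M}(\mathbb{R}^d)$, and any minimizer of $E_{W,U}$ in $\mathcal{M}(\mathbb{R}^d)$ is compactly supported.
   Context: $\mathcal{M}(\mathbb{R}^d)$ is the set of Borel probability measures on $\mathbb{R}^d$. $E_{W,U}[\rho]=\frac12\int\int W(\mathbf{x}-\mathbf{y})\,d\rho(\mathbf{y})\,d\rho(\mathbf{x})+\int U(\mathbf{x})\,d\rho(\mathbf{x})$, with values in $\mathbb{R}\cup\{\infty\}$. *)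

theory Defs
  imports "HOL-Probability.Probability"
begin

definition borel_prob_measures :: "'a::topological_space measure set" where
  "borel_prob_measures = {\<rho>. prob_space \<rho> \<and> sets \<rho> = sets borel}"

text \<open>Integral of an extended real function, as the integral of the positive part minus that of
  the negative part. For a measurable function that is bounded below and a finite measure the
  second term is finite, so the difference is never of the form \<open>\<infinity> - \<infinity>\<close>.\<close>

definition ereal_integral :: "'a measure \<Rightarrow> ('a \<Rightarrow> ereal) \<Rightarrow> ereal" where
  "ereal_integral M f =
     enn2ereal (\<integral>\<^sup>+x. e2ennreal (f x) \<partial>M) - enn2ereal (\<integral>\<^sup>+x. e2ennreal (- f x) \<partial>M)"

definition energy ::
  "('a::euclidean_space \<Rightarrow> ereal) \<Rightarrow> ('a \<Rightarrow> ereal) \<Rightarrow> 'a measure \<Rightarrow> ereal" where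
  "energy W U \<rho> =
     ereal (1/2) * ereal_integral \<rho> (\<lambda>x. ereal_integral \<rho> (\<lambda>y. W (x - y)))
     + ereal_integral \<rho> U"

definition locally_integrable :: "('a::euclidean_space \<Rightarrow> ereal) \<Rightarrow> bool" where
  "locally_integrable f \<longleftrightarrow> f \<in> borel_measurable lebesgue \<and>
     (\<forall>K. compact K \<longrightarrow> (\<integral>\<^sup>+x\<in>K. e2ennreal \<bar>f x\<bar> \<partial>lebesgue) < \<infinity>)"

text \<open>The real lower bound also excludes the value \<open>-\<infinity>\<close>.\<close>

definition bounded_from_below :: "('a \<Rightarrow> ereal) \<Rightarrow> bool" where
  "bounded_from_below f \<longleftrightarrow> (\<exists>c::real. \<forall>x. ereal c \<le> f x)"

definition lower_semicontinuous :: "('a::topological_space \<Rightarrow> ereal) \<Rightarrow> bool" where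
  "lower_semicontinuous f \<longleftrightarrow> (\<forall>x. f x \<le> Liminf (at x) f)"

definition measure_support :: "'a::topological_space measure \<Rightarrow> 'a set" where
  "measure_support \<rho> = {x. \<forall>V. open V \<longrightarrow> x \<in> V \<longrightarrow> emeasure \<rho> V > 0}"

definition minimizer ::
  "('a::euclidean_space \<Rightarrow> ereal) \<Rightarrow> ('a \<Rightarrow> ereal) \<Rightarrow> 'a measure \<Rightarrow> bool" where
  "minimizer W U \<rho> \<longleftrightarrow> is_arg_min (energy W U) (\<lambda>\<sigma>. \<sigma> \<in> borel_prob_measures) \<rho>"

end

theory Submission
  imports Defs
begin

text \<open>Subtracting the infima of \<open>W\<close> and \<open>U\<close> changes the energy by a constant only, so let both be
  nonnegative with infimum \<open>0\<close>; the hypothesis then says that some measure has energy below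
  \<open>U_inf / 2\<close>. Pick a real \<open>c < U_inf\<close> such that energies below \<open>c / 2\<close> occur, and a closed ball
  \<open>K\<close> outside of which \<open>U \<ge> c\<close>.

  Everything rests on one inequality. Let \<open>\<rho>\<close> have energy \<open>s < c / 2\<close> and put \<open>\<alpha> = \<rho> K\<close>. With \<open>A\<close>
  and \<open>B\<close> the interaction and confinement energy of the part of \<open>\<rho>\<close> inside \<open>K\<close>, discarding the
  interactions with the outside gives \<open>A + B + c * (1 - \<alpha>) \<le> s\<close>. The measure \<open>\<rho>\<close> conditioned on
  \<open>K\<close> has energy \<open>A / \<alpha>\<^sup>2 + B / \<alpha>\<close>, and
  \<open>A + \<alpha> * B \<le> s - c * (1 - \<alpha>) \<le> s - 2 * s * (1 - \<alpha>) \<le> s * \<alpha>\<^sup>2\<close>.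
  So conditioning on \<open>K\<close> does not increase the energy, and strictly decreases it if \<open>\<alpha> < 1\<close>
  (\<open>truncation_decreases_energy\<close>). Consequently every minimizer lives on \<open>K\<close>, which is the claim
  on supports, and a minimizing sequence may be taken to live on \<open>K\<close>.

  Existence is then the direct method on the probability measures on a compact set. Instead of weak
  compactness in Euclidean space, the compact set is encoded in the unit interval by a Borel map that
  has a continuous left inverse (\<open>compact_borel_code\<close>). Helly selection and the Skorohod
  representation on the line, transported back along the left inverse, turn a subsequence of the
  measures into laws of pointwise convergent random variables
  (\<open>compactly_supported_laws_converge_pointwise\<close>). For these, lower semicontinuity of the energy is
  Fatou's lemma (\<open>nonneg_energy_le_liminf\<close>).\<close>

section \<open>Lower semicontinuity of nonnegative energies\<close>

lemma lsc_le_liminf: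
  fixes f :: "'a::topological_space \<Rightarrow> ennreal"
  assumes "\<And>a. open {x. a < f x}" and "X \<longlonglongrightarrow> x"
  shows "f x \<le> liminf (\<lambda>n. f (X n))"
  unfolding le_Liminf_iff
proof (intro allI impI)
  fix a assume "a < f x"
  then show "\<forall>\<^sub>F n in sequentially. a < f (X n)"
    using topological_tendstoD[OF assms(2,1), of a] by simp
qed

lemma lsc_borel_measurable:
  fixes f :: "'a::topological_space \<Rightarrow> ennreal"
  assumes "\<And>a. open {x. a < f x}"
  shows "f \<in> borel_measurable borel"
  by (rule borel_measurableI_greater) (use assms in simp)

text \<open>The factor one half of the interaction term is absorbed in \<open>w\<close>. With values in \<open>ennreal\<close> the
  convergence theorems for the nonnegative integral apply without integrability conditions.\<close>

definition nonneg_energy ::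
    "('a::euclidean_space \<Rightarrow> ennreal) \<Rightarrow> ('a \<Rightarrow> ennreal) \<Rightarrow> 'a measure \<Rightarrow> ennreal" where
  "nonneg_energy w v \<rho> = (\<integral>\<^sup>+x. \<integral>\<^sup>+y. w (x - y) \<partial>\<rho> \<partial>\<rho>) + (\<integral>\<^sup>+x. v x \<partial>\<rho>)"

lemma borel_measurable_potential:
  fixes w :: "'a::euclidean_space \<Rightarrow> ennreal"
  assumes "prob_space \<rho>" and [measurable_cong]: "sets \<rho> = sets borel"
    and [measurable]: "w \<in> borel_measurable borel"
  shows "(\<lambda>x. \<integral>\<^sup>+y. w (x - y) \<partial>\<rho>) \<in> borel_measurable borel"
proof -
  interpret prob_space \<rho> by fact
  show ?thesis by measurable
qed

lemma nonneg_energy_distr: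
  fixes w :: "'a::euclidean_space \<Rightarrow> ennreal"
  assumes "prob_space \<Omega>" and [measurable]: "X \<in> borel_measurable \<Omega>"
    and [measurable]: "w \<in> borel_measurable borel" "v \<in> borel_measurable borel"
  shows "nonneg_energy w v (distr \<Omega> borel X) =
    (\<integral>\<^sup>+s. \<integral>\<^sup>+t. w (X s - X t) \<partial>\<Omega> \<partial>\<Omega>) + (\<integral>\<^sup>+s. v (X s) \<partial>\<Omega>)"
proof -
  interpret prob_space \<Omega> by fact
  have [measurable]: "(\<lambda>x. \<integral>\<^sup>+y. w (x - y) \<partial>distr \<Omega> borel X) \<in> borel_measurable borel"
    by (rule borel_measurable_potential) (auto intro: prob_space_distr)
  show ?thesis
    unfolding nonneg_energy_def by (simp add: nn_integral_distr)
qed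

lemma liminf_add_le:
  fixes a b :: "nat \<Rightarrow> ennreal"
  shows "liminf a + liminf b \<le> liminf (\<lambda>n. a n + b n)"
proof -
  have "liminf a + liminf b = (SUP n. (INF i\<in>{n..}. a i) + (INF i\<in>{n..}. b i))"
    unfolding liminf_SUP_INF
    by (rule ennreal_SUP_add[symmetric]) (auto intro!: incseq_SucI INF_superset_mono)
  also have "\<dots> \<le> (SUP n. INF i\<in>{n..}. a i + b i)"
    by (intro SUP_mono' INF_greatest add_mono INF_lower) auto
  finally show ?thesis unfolding liminf_SUP_INF .
qed

text \<open>Realising the measures as laws on one probability space replaces the convergence of the product
  measures by pointwise convergence of \<open>X n s - X n t\<close>; Fatou's lemma is then applied once in each
  variable.\<close>

lemma nonneg_energy_le_liminf:
  fixes w v :: "'a::euclidean_space \<Rightarrow> ennreal"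
  assumes "prob_space \<Omega>" and [measurable]: "\<And>n. X n \<in> borel_measurable \<Omega>" "Y \<in> borel_measurable \<Omega>"
    and conv: "\<And>t. t \<in> space \<Omega> \<Longrightarrow> (\<lambda>n. X n t) \<longlonglongrightarrow> Y t"
    and w: "\<And>a. open {x. a < w x}" and v: "\<And>a. open {x. a < v x}"
  shows "nonneg_energy w v (distr \<Omega> borel Y) \<le> liminf (\<lambda>n. nonneg_energy w v (distr \<Omega> borel (X n)))"
proof -
  interpret prob_space \<Omega> by fact
  note [measurable] = lsc_borel_measurable[OF w] lsc_borel_measurable[OF v]
  have "(\<integral>\<^sup>+s. \<integral>\<^sup>+t. w (Y s - Y t) \<partial>\<Omega> \<partial>\<Omega>)
      \<le> (\<integral>\<^sup>+s. \<integral>\<^sup>+t. liminf (\<lambda>n. w (X n s - X n t)) \<partial>\<Omega> \<partial>\<Omega>)"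
    by (intro nn_integral_mono lsc_le_liminf[OF w] tendsto_diff conv)
  also have "\<dots> \<le> (\<integral>\<^sup>+s. liminf (\<lambda>n. \<integral>\<^sup>+t. w (X n s - X n t) \<partial>\<Omega>) \<partial>\<Omega>)"
    by (intro nn_integral_mono nn_integral_liminf) measurable
  also have "\<dots> \<le> liminf (\<lambda>n. \<integral>\<^sup>+s. \<integral>\<^sup>+t. w (X n s - X n t) \<partial>\<Omega> \<partial>\<Omega>)"
    by (intro nn_integral_liminf) measurable
  finally have 1: "(\<integral>\<^sup>+s. \<integral>\<^sup>+t. w (Y s - Y t) \<partial>\<Omega> \<partial>\<Omega>)
      \<le> liminf (\<lambda>n. \<integral>\<^sup>+s. \<integral>\<^sup>+t. w (X n s - X n t) \<partial>\<Omega> \<partial>\<Omega>)" .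
  have "(\<integral>\<^sup>+s. v (Y s) \<partial>\<Omega>) \<le> (\<integral>\<^sup>+s. liminf (\<lambda>n. v (X n s)) \<partial>\<Omega>)"
    by (intro nn_integral_mono lsc_le_liminf[OF v] conv)
  also have "\<dots> \<le> liminf (\<lambda>n. \<integral>\<^sup>+s. v (X n s) \<partial>\<Omega>)"
    by (intro nn_integral_liminf) measurable
  finally have 2: "(\<integral>\<^sup>+s. v (Y s) \<partial>\<Omega>) \<le> liminf (\<lambda>n. \<integral>\<^sup>+s. v (X n s) \<partial>\<Omega>)" .
  show ?thesis
    using order_trans[OF add_mono[OF 1 2] liminf_add_le]
    by (simp add: nonneg_energy_distr[OF \<open>prob_space \<Omega>\<close>])
qed

section \<open>Conditioning on a compact set\<close>

text \<open>Multiplied by \<open>\<alpha>\<^sup>2\<close> the claim reads \<open>a + \<alpha> * b \<le> s * \<alpha>\<^sup>2\<close>. It follows from \<open>\<alpha> * b \<le> b\<close>, from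
  \<open>2 * s < c\<close> and from \<open>0 \<le> s * (1 - \<alpha>)\<^sup>2\<close>; the second of these is used with the factor \<open>1 - \<alpha>\<close>,
  whence strictness for \<open>\<alpha> < 1\<close>.\<close>

lemma truncation_inequality:
  fixes a b c s \<alpha> :: real
  assumes "0 \<le> a" "0 \<le> b" "0 \<le> s" "2 * s < c" "0 < \<alpha>" "\<alpha> \<le> 1" "a + b + c * (1 - \<alpha>) \<le> s"
  shows "a / \<alpha> / \<alpha> + b / \<alpha> \<le> s" and "\<alpha> < 1 \<Longrightarrow> a / \<alpha> / \<alpha> + b / \<alpha> < s"
proof -
  have \<alpha>b: "\<alpha> * b \<le> b" using assms by (simp add: mult_left_le_one_le)
  have "2 * s * (1 - \<alpha>) \<le> c * (1 - \<alpha>)" using assms by (intro mult_right_mono) auto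
  moreover have sq: "s - 2 * s * (1 - \<alpha>) \<le> s * (\<alpha> * \<alpha>)"
  proof -
    have "0 \<le> s * ((1 - \<alpha>) * (1 - \<alpha>))" using assms by simp
    then show ?thesis by (simp add: algebra_simps)
  qed
  ultimately have "a + \<alpha> * b \<le> s * (\<alpha> * \<alpha>)" using \<alpha>b assms(7) by linarith
  then show "a / \<alpha> / \<alpha> + b / \<alpha> \<le> s" using assms by (simp add: field_simps)
  assume "\<alpha> < 1"
  then have "2 * s * (1 - \<alpha>) < c * (1 - \<alpha>)" using assms by (intro mult_strict_right_mono) auto
  then have "a + \<alpha> * b < s * (\<alpha> * \<alpha>)" using \<alpha>b assms(7) sq by linarith
  then show "a / \<alpha> / \<alpha> + b / \<alpha> < s" using assms by (simp add: field_simps)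
qed

text \<open>Mass outside of \<open>K\<close> costs at least \<open>c\<close> per unit, more than twice the energy of \<open>\<rho>\<close>. Moving it
  into \<open>K\<close> by rescaling multiplies the inner interaction energy by \<open>1 / \<alpha>\<^sup>2\<close>, that is by about
  \<open>1 + 2 * (1 - \<alpha>)\<close> when little mass is moved: the factor two is what the saving compensates.\<close>

lemma truncation_decreases_energy:
  fixes w v :: "'a::euclidean_space \<Rightarrow> ennreal"
  assumes "prob_space \<rho>" and sets[measurable_cong]: "sets \<rho> = sets borel"
    and [measurable]: "w \<in> borel_measurable borel" "v \<in> borel_measurable borel" "K \<in> sets borel"
    and far: "\<And>x. x \<notin> K \<Longrightarrow> ennreal c \<le> v x"
    and low: "2 * nonneg_energy w v \<rho> < ennreal c"
  shows "0 < emeasure \<rho> K"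
    and "nonneg_energy w v (uniform_measure \<rho> K) \<le> nonneg_energy w v \<rho>"
    and "emeasure \<rho> K \<noteq> 1 \<Longrightarrow> nonneg_energy w v (uniform_measure \<rho> K) < nonneg_energy w v \<rho>"
proof -
  interpret prob_space \<rho> by fact
  define F where "F = nonneg_energy w v \<rho>"
  define A where "A = (\<integral>\<^sup>+x. (\<integral>\<^sup>+y. w (x - y) * indicator K y \<partial>\<rho>) * indicator K x \<partial>\<rho>)"
  define B where "B = (\<integral>\<^sup>+x. v x * indicator K x \<partial>\<rho>)"
  define \<alpha> where "\<alpha> = measure \<rho> K"
  have \<alpha>: "emeasure \<rho> K = ennreal \<alpha>" "0 \<le> \<alpha>" "\<alpha> \<le> 1"
    unfolding \<alpha>_def by (auto simp: emeasure_eq_measure)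
  have K': "emeasure \<rho> (- K) = ennreal (1 - \<alpha>)"
    using prob_compl[of K] sets_eq_imp_space_eq[OF sets] unfolding \<alpha>_def
    by (simp add: emeasure_eq_measure Compl_eq_Diff_UNIV sets)
  have "A \<le> (\<integral>\<^sup>+x. \<integral>\<^sup>+y. w (x - y) \<partial>\<rho> \<partial>\<rho>)"
    unfolding A_def
  proof (rule nn_integral_mono)
    fix x
    have "(\<integral>\<^sup>+y. w (x - y) * indicator K y \<partial>\<rho>) \<le> (\<integral>\<^sup>+y. w (x - y) \<partial>\<rho>)"
      by (intro nn_integral_mono) (simp split: split_indicator)
    then show "(\<integral>\<^sup>+y. w (x - y) * indicator K y \<partial>\<rho>) * indicator K x \<le> (\<integral>\<^sup>+y. w (x - y) \<partial>\<rho>)"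
      by (simp split: split_indicator)
  qed
  moreover have "B + ennreal c * emeasure \<rho> (- K) \<le> (\<integral>\<^sup>+x. v x \<partial>\<rho>)"
  proof -
    have "B + ennreal c * emeasure \<rho> (- K)
        = (\<integral>\<^sup>+x. v x * indicator K x + ennreal c * indicator (- K) x \<partial>\<rho>)"
      unfolding B_def by (subst nn_integral_add) (auto simp: nn_integral_cmult_indicator sets)
    also have "\<dots> \<le> (\<integral>\<^sup>+x. v x \<partial>\<rho>)"
      using far by (intro nn_integral_mono) (auto split: split_indicator)
    finally show ?thesis .
  qed
  ultimately have le: "A + (B + ennreal c * ennreal (1 - \<alpha>)) \<le> F"
    unfolding F_def nonneg_energy_def K' by (rule add_mono)
  have "F \<noteq> \<top>" using low unfolding F_def[symmetric] by (auto simp: ennreal_mult_top)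
  then obtain s where s: "F = ennreal s" "0 \<le> s" by (cases F) auto
  have "A \<noteq> \<top>" "B \<noteq> \<top>" using le s(1) by (auto simp: top_unique)
  then obtain a b where a: "A = ennreal a" "0 \<le> a" and b: "B = ennreal b" "0 \<le> b"
    by (cases A; cases B) auto
  have "ennreal (2 * s) < ennreal c" using low s unfolding F_def[symmetric] by (simp add: ennreal_mult)
  then have c: "2 * s < c" "0 < c" using s(2) by (auto simp: ennreal_less_iff)
  have "ennreal (a + b + c * (1 - \<alpha>)) \<le> ennreal s"
    using le a b \<alpha> c by (simp add: s(1) ennreal_mult add.assoc)
  then have split: "a + b + c * (1 - \<alpha>) \<le> s" using s(2) by simp
  have "\<alpha> \<noteq> 0" using split a b c s by auto
  then have \<alpha>0: "0 < \<alpha>" using \<alpha>(2) by simp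
  then show "0 < emeasure \<rho> K" using \<alpha>(1) by simp
  have "nonneg_energy w v (uniform_measure \<rho> K) = A / ennreal \<alpha> / ennreal \<alpha> + B / ennreal \<alpha>"
  proof -
    have "(\<integral>\<^sup>+x. \<integral>\<^sup>+y. w (x - y) \<partial>uniform_measure \<rho> K \<partial>uniform_measure \<rho> K)
        = (\<integral>\<^sup>+x. (\<integral>\<^sup>+y. w (x - y) * indicator K y \<partial>\<rho>) / ennreal \<alpha> \<partial>uniform_measure \<rho> K)"
      by (simp add: nn_integral_uniform_measure sets \<alpha>)
    also have "\<dots> = (\<integral>\<^sup>+x. (\<integral>\<^sup>+y. w (x - y) * indicator K y \<partial>\<rho>) / ennreal \<alpha> * indicator K x \<partial>\<rho>) / ennreal \<alpha>"
      by (subst nn_integral_uniform_measure) (auto simp: sets \<alpha>)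
    also have "\<dots> = (\<integral>\<^sup>+x. ((\<integral>\<^sup>+y. w (x - y) * indicator K y \<partial>\<rho>) * indicator K x) / ennreal \<alpha> \<partial>\<rho>) / ennreal \<alpha>"
      by (simp add: divide_ennreal_def mult_ac)
    also have "\<dots> = A / ennreal \<alpha> / ennreal \<alpha>"
      unfolding A_def by (subst nn_integral_divide) auto
    finally show ?thesis
      unfolding nonneg_energy_def B_def by (simp add: nn_integral_uniform_measure sets \<alpha>)
  qed
  also have "\<dots> = ennreal (a / \<alpha> / \<alpha> + b / \<alpha>)"
    using a b \<alpha>0 by (simp add: divide_ennreal)
  finally have eq: "nonneg_energy w v (uniform_measure \<rho> K) = ennreal (a / \<alpha> / \<alpha> + b / \<alpha>)" .
  note ineq = truncation_inequality[OF a(2) b(2) s(2) c(1) \<alpha>0 \<alpha>(3) split]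
  show "nonneg_energy w v (uniform_measure \<rho> K) \<le> nonneg_energy w v \<rho>"
    unfolding eq F_def[symmetric] s(1) using ineq(1) by (rule ennreal_leI)
  assume "emeasure \<rho> K \<noteq> 1"
  then have "\<alpha> < 1" using \<alpha> by (cases "\<alpha> = 1") auto
  then show "nonneg_energy w v (uniform_measure \<rho> K) < nonneg_energy w v \<rho>"
    unfolding eq F_def[symmetric] s(1) using ineq(2) a b \<alpha>0 by (intro ennreal_lessI) (auto intro: le_less_trans[rotated])
qed

section \<open>Compactness of measures on a compact set\<close>

text \<open>The Cantor set coding of binary sequences. Only the digits 0 and 2 occur, so that, in contrast to
  binary expansions, nearby numbers have the same leading digits.\<close>

definition ternary :: "(nat \<Rightarrow> bool) \<Rightarrow> real" where
  "ternary b = (\<Sum>k. 2 * of_bool (b k) / 3 ^ Suc k)"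

lemma ternary_summable: "summable (\<lambda>k. 2 * of_bool (b k) / (3::real) ^ Suc k)"
proof (rule summable_comparison_test)
  show "\<exists>N. \<forall>k\<ge>N. norm (2 * of_bool (b k) / (3::real) ^ Suc k) \<le> 2/3 * (1/3) ^ k"
    by (auto simp: power_divide)
  show "summable (\<lambda>k. 2/3 * (1/3::real) ^ k)"
    by (intro summable_mult summable_geometric) auto
qed

lemma ternary_rec: "ternary b = (2 * of_bool (b 0) + ternary (\<lambda>k. b (Suc k))) / 3"
proof -
  have "ternary b = (\<Sum>k. 2 * of_bool (b (Suc k)) / (3::real) ^ Suc (Suc k)) + 2 * of_bool (b 0) / 3"
    unfolding ternary_def using suminf_split_head[OF ternary_summable[of b]] by simp
  also have "(\<Sum>k. 2 * of_bool (b (Suc k)) / (3::real) ^ Suc (Suc k)) =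
      (\<Sum>k. 2 * of_bool (b (Suc k)) / (3::real) ^ Suc k / 3)"
    by (simp add: field_simps)
  also have "\<dots> = ternary (\<lambda>k. b (Suc k)) / 3"
    unfolding ternary_def by (rule suminf_divide[OF ternary_summable])
  finally show ?thesis by (simp add: field_simps)
qed

lemma ternary_bounds: "0 \<le> ternary b" "ternary b \<le> 1"
proof -
  show "0 \<le> ternary b"
    unfolding ternary_def by (intro suminf_nonneg ternary_summable) auto
  have "ternary b \<le> (\<Sum>k. 2/3 * (1/3::real) ^ k)"
    unfolding ternary_def
    by (intro suminf_le ternary_summable summable_mult summable_geometric) (auto simp: power_divide)
  also have "\<dots> = 1"
    by (subst suminf_mult) (auto simp: suminf_geometric)
  finally show "ternary b \<le> 1" .
qed

lemma ternary_close_imp_digits_eq: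
  assumes "\<bar>ternary a - ternary b\<bar> < 1 / 3 ^ n" and "k < n"
  shows "a k = b k"
  using assms
proof (induction n arbitrary: a b k)
  case (Suc n)
  \<comment> \<open>Different leading digits force a distance of at least \<open>(2 - 1) / 3\<close>, the tails lying in the unit interval.\<close>
  have "1 / (3::real) ^ Suc n \<le> 1 / 3" by (simp add: field_simps)
  then have lt: "\<bar>ternary a - ternary b\<bar> < 1 / 3"
    using Suc.prems(1) by linarith
  have head: "a 0 = b 0"
  proof (rule ccontr)
    assume "a 0 \<noteq> b 0"
    then have "\<bar>2 * of_bool (a 0) - 2 * of_bool (b 0)\<bar> = (2::real)" by auto
    moreover have "\<bar>(2 * of_bool (a 0) - 2 * of_bool (b 0)) + (ternary (\<lambda>k. a (Suc k)) - ternary (\<lambda>k. b (Suc k)))\<bar> < 1"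
      using lt unfolding ternary_rec[of a] ternary_rec[of b] by (simp add: field_simps)
    moreover have "\<bar>ternary (\<lambda>k. a (Suc k)) - ternary (\<lambda>k. b (Suc k))\<bar> \<le> 1"
      using ternary_bounds[of "\<lambda>k. a (Suc k)"] ternary_bounds[of "\<lambda>k. b (Suc k)"] by (simp add: abs_le_iff)
    ultimately show False by argo
  qed
  then have "ternary (\<lambda>k. a (Suc k)) - ternary (\<lambda>k. b (Suc k)) = 3 * (ternary a - ternary b)"
    unfolding ternary_rec[of a] ternary_rec[of b] by (simp add: field_simps)
  then have "\<bar>ternary (\<lambda>k. a (Suc k)) - ternary (\<lambda>k. b (Suc k))\<bar> = 3 * \<bar>ternary a - ternary b\<bar>"
    by (simp only: abs_mult abs_numeral)
  also have "\<dots> < 1 / 3 ^ n" using Suc.prems(1) by (simp add: field_simps)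
  finally have "\<bar>ternary (\<lambda>k. a (Suc k)) - ternary (\<lambda>k. b (Suc k))\<bar> < 1 / 3 ^ n" .
  then have "a (Suc j) = b (Suc j)" if "j < n" for j
    using Suc.IH[of "\<lambda>k. a (Suc k)" "\<lambda>k. b (Suc k)" j] that by simp
  with head Suc.prems(2) show ?case by (cases k) auto
qed simp

text \<open>The code of \<open>x\<close> records which members \<open>A k\<close> of a countable base contain \<open>x\<close>. By compactness finitely
  many small \<open>A k\<close> cover \<open>K\<close>, so finitely many digits locate a point of \<open>K\<close> up to a given
  precision: decoding is uniformly continuous on the image of \<open>K\<close>. It therefore extends
  continuously to the closure of the image, and by Tietze's theorem to the whole line.\<close>

lemma compact_borel_code:
  fixes K :: "'a::euclidean_space set"
  assumes "compact K"
  obtains s :: "'a \<Rightarrow> real" and \<phi> :: "real \<Rightarrow> 'a"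
  where "s \<in> borel_measurable borel" "\<And>x. s x \<in> {0..1}"
    "continuous_on UNIV \<phi>" "\<And>x. x \<in> K \<Longrightarrow> \<phi> (s x) = x"
proof -
  obtain \<B> :: "'a set set" where \<B>: "countable \<B>" "topological_basis \<B>"
    using ex_countable_basis by blast
  define A where "A = from_nat_into \<B>"
  have "\<B> \<noteq> {}" using \<B>(2) by (metis UNIV_not_empty Union_empty subset_empty open_UNIV topological_basis_def)
  then have rangeA: "range A = \<B>" unfolding A_def using \<B>(1) by (rule range_from_nat_into)
  have openA: "open (A k)" for k
    using \<B>(2) rangeA topological_basis_open by blast
  define s where "s x = ternary (\<lambda>k. x \<in> A k)" for x
  have [measurable]: "A k \<in> sets borel" for k using openA by auto
  have s_meas: "s \<in> borel_measurable borel"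
    unfolding s_def ternary_def by measurable
  have uniform: "\<exists>d>0. \<forall>x\<in>K. \<forall>y\<in>K. \<bar>s x - s y\<bar> < d \<longrightarrow> dist x y < e" if "e > 0" for e
  proof -
    define C where "C = {k. \<exists>z. A k \<subseteq> ball z (e/2)}"
    have "K \<subseteq> (\<Union>k\<in>C. A k)"
    proof
      fix x
      obtain V where "V \<in> \<B>" "x \<in> V" "V \<subseteq> ball x (e/2)"
        using topological_basisE[OF \<B>(2), of "ball x (e/2)" x] \<open>e > 0\<close> by auto
      then show "x \<in> (\<Union>k\<in>C. A k)" using rangeA unfolding C_def by blast
    qed
    then obtain D where D: "D \<subseteq> C" "finite D" "K \<subseteq> (\<Union>k\<in>D. A k)"
      using compactE_image[OF assms, of C A] openA by metis
    obtain n where n: "\<And>k. k \<in> D \<Longrightarrow> k < n"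
      using D(2) finite_nat_set_iff_bounded by auto
    have "dist x y < e" if "x \<in> K" "\<bar>s x - s y\<bar> < 1 / 3 ^ n" for x y
    proof -
      have "x \<in> (\<Union>k\<in>D. A k)" using D(3) that(1) by blast
      then obtain k where k: "k \<in> D" "x \<in> A k" by blast
      then have "y \<in> A k"
        using ternary_close_imp_digits_eq[OF that(2)[unfolded s_def], of k] n by auto
      moreover obtain z where "A k \<subseteq> ball z (e/2)" using k D(1) C_def by auto
      ultimately have "dist z x < e/2" "dist z y < e/2" using k(2) by auto
      then show ?thesis by (metis dist_commute dist_triangle_half_l)
    qed
    then show ?thesis by (intro exI[of _ "1 / 3 ^ n"]) auto
  qed
  have inj: "inj_on s K"
  proof (rule inj_onI, rule ccontr)
    fix x y assume xy: "x \<in> K" "y \<in> K" "s x = s y" "x \<noteq> y"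
    then obtain d where "d > 0" "\<forall>x'\<in>K. \<forall>y'\<in>K. \<bar>s x' - s y'\<bar> < d \<longrightarrow> dist x' y' < dist x y"
      using uniform[of "dist x y"] by auto
    then have "dist x y < dist x y" using xy by (metis abs_zero diff_self)
    then show False by simp
  qed
  have "uniformly_continuous_on (s ` K) (inv_into K s)"
    unfolding uniformly_continuous_on_def
  proof (intro allI impI)
    fix e :: real assume "e > 0"
    then obtain d where "d > 0" "\<forall>x\<in>K. \<forall>y\<in>K. \<bar>s x - s y\<bar> < d \<longrightarrow> dist x y < e"
      using uniform by blast
    then show "\<exists>d>0. \<forall>t\<in>s ` K. \<forall>t'\<in>s ` K. dist t' t < d \<longrightarrow> dist (inv_into K s t') (inv_into K s t) < e"
      using inj by (intro exI[of _ d]) (auto simp: dist_real_def inv_into_f_f)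
  qed
  then obtain g where g: "uniformly_continuous_on (closure (s ` K)) g"
      "\<And>t. t \<in> s ` K \<Longrightarrow> inv_into K s t = g t"
    by (rule uniformly_continuous_on_extension_on_closure) blast
  obtain \<phi> where \<phi>: "continuous_on UNIV \<phi>" "\<And>t. t \<in> closure (s ` K) \<Longrightarrow> \<phi> t = g t"
    using Tietze_unbounded[OF uniformly_continuous_imp_continuous[OF g(1)], of UNIV] by auto
  have "\<phi> (s x) = x" if "x \<in> K" for x
    using that \<phi>(2)[of "s x"] g(2)[of "s x"] inj closure_subset[of "s ` K"] by (auto simp: inv_into_f_f)
  moreover have "s x \<in> {0..1}" for x unfolding s_def using ternary_bounds by auto
  ultimately show thesis using that s_meas \<phi>(1) by blast
qed

text \<open>A substitute for the weak compactness of the probability measures on a compact set. The encoded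
  measures live on the unit interval, hence are tight; since the decoding map is continuous, it
  preserves the pointwise convergence of Skorohod's representation.\<close>

lemma compactly_supported_laws_converge_pointwise:
  fixes \<rho> :: "nat \<Rightarrow> 'a::euclidean_space measure"
  assumes "compact K" and prob: "\<And>n. prob_space (\<rho> n)"
    and sets: "\<And>n. sets (\<rho> n) = sets borel"
    and conc: "\<And>n. emeasure (\<rho> n) K = 1"
  obtains r :: "nat \<Rightarrow> nat" and \<Omega> :: "real measure" and X Y
  where "strict_mono r" "prob_space \<Omega>"
    "\<And>n. X n \<in> borel_measurable \<Omega>" "\<And>n. distr \<Omega> borel (X n) = \<rho> (r n)"
    "Y \<in> borel_measurable \<Omega>" "\<And>t. t \<in> space \<Omega> \<Longrightarrow> (\<lambda>n. X n t) \<longlonglongrightarrow> Y t"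
proof -
  obtain s :: "'a \<Rightarrow> real" and \<phi> :: "real \<Rightarrow> 'a"
    where s: "s \<in> borel_measurable borel" "\<And>x. s x \<in> {0..1}"
      and \<phi>: "continuous_on UNIV \<phi>" "\<And>x. x \<in> K \<Longrightarrow> \<phi> (s x) = x"
    using compact_borel_code[OF assms(1)] by blast
  have \<phi>_meas: "\<phi> \<in> borel_measurable borel"
    using \<phi>(1) by (rule borel_measurable_continuous_onI)
  have sM: "s \<in> measurable (\<rho> n) borel" for n
    using s(1) sets measurable_cong_sets by blast
  define \<mu> where "\<mu> n = distr (\<rho> n) borel s" for n
  have dist: "real_distribution (\<mu> n)" for n
    unfolding \<mu>_def using prob_space.real_distribution_distr[OF prob sM] .
  have "measure (\<mu> n) {-1<..1} = 1" for n
  proof -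
    have "s -` {-1<..1} \<inter> space (\<rho> n) = space (\<rho> n)"
    proof -
      have "s x \<in> {-1<..1}" for x using s(2)[of x] by auto
      then show ?thesis by auto
    qed
    then show ?thesis
      unfolding \<mu>_def by (simp add: measure_distr[OF sM] prob_space.prob_space[OF prob])
  qed
  then have "tight \<mu>"
    unfolding tight_def using dist by (intro conjI allI impI exI[of _ "-1"] exI[of _ 1]) auto
  then obtain r M where r: "strict_mono (r :: nat \<Rightarrow> nat)" "real_distribution M"
      "weak_conv_m (\<mu> \<circ> id \<circ> r) M"
    using tight_imp_convergent_subsubsequence[of \<mu> id] by (auto simp: strict_mono_def)
  have dist': "real_distribution ((\<mu> \<circ> id \<circ> r) n)" for n using dist by simp
  obtain \<Omega> :: "real measure" and S T where "prob_space \<Omega> \<and> (\<forall>n. S n \<in> borel_measurable \<Omega>)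
      \<and> (\<forall>n. distr \<Omega> borel (S n) = (\<mu> \<circ> id \<circ> r) n) \<and> T \<in> measurable \<Omega> lborel \<and> distr \<Omega> borel T = M
      \<and> (\<forall>t\<in>space \<Omega>. (\<lambda>n. S n t) \<longlonglongrightarrow> T t)"
    using Skorohod[OF dist' r(2) r(3)] by blast
  then have \<Omega>: "prob_space \<Omega>" "\<And>n. S n \<in> borel_measurable \<Omega>"
      "\<And>n. distr \<Omega> borel (S n) = \<mu> (r n)" "T \<in> borel_measurable \<Omega>"
      "\<And>t. t \<in> space \<Omega> \<Longrightarrow> (\<lambda>n. S n t) \<longlonglongrightarrow> T t"
    by simp_all
  show thesis
  proof (rule that[of r \<Omega> "\<lambda>n t. \<phi> (S n t)" "\<lambda>t. \<phi> (T t)"])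
    show "distr \<Omega> borel (\<lambda>t. \<phi> (S n t)) = \<rho> (r n)" for n
    proof -
      \<comment> \<open>Decoding the encoded measure gives \<open>\<rho> (r n)\<close> back, as almost every point lies in \<open>K\<close>.\<close>
      have "distr \<Omega> borel (\<lambda>t. \<phi> (S n t)) = distr (\<mu> (r n)) borel \<phi>"
        unfolding \<Omega>(3)[symmetric] by (subst distr_distr[OF \<phi>_meas \<Omega>(2)]) (simp add: comp_def)
      also have "\<dots> = distr (\<rho> (r n)) borel (\<lambda>x. \<phi> (s x))"
        unfolding \<mu>_def by (subst distr_distr[OF \<phi>_meas sM]) (simp add: comp_def)
      also have "\<dots> = distr (\<rho> (r n)) borel (\<lambda>x. x)"
      proof (rule distr_cong_AE)
        have "AE x in \<rho> (r n). x \<in> K"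
          using conc prob sets assms(1)
          by (intro prob_space.AE_prob_1) (auto simp: measure_def)
        then show "AE x in \<rho> (r n). \<phi> (s x) = x" by eventually_elim (rule \<phi>(2))
      qed (use sM \<phi>_meas sets in \<open>auto intro: measurable_compose simp: measurable_ident_sets\<close>)
      also have "\<dots> = \<rho> (r n)" by (rule distr_id2) (simp add: sets)
      finally show ?thesis .
    qed
    show "(\<lambda>n. \<phi> (S n t)) \<longlonglongrightarrow> \<phi> (T t)" if "t \<in> space \<Omega>" for t
      using continuous_on_tendsto_compose[OF \<phi>(1) \<Omega>(5)[OF that]] by auto
  qed (use r \<Omega> \<phi>_meas in \<open>auto intro: measurable_compose\<close>)
qed

section \<open>Existence of a minimizer\<close>

lemma uniform_measure_in_borel_prob_measures:
  assumes "\<rho> \<in> borel_prob_measures" and "0 < emeasure \<rho> K"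
  shows "uniform_measure \<rho> K \<in> borel_prob_measures"
proof -
  interpret prob_space \<rho> using assms(1) by (simp add: borel_prob_measures_def)
  show ?thesis
    using assms prob_space_uniform_measure[of \<rho> K]
    by (auto simp: borel_prob_measures_def emeasure_eq_measure)
qed

text \<open>The direct method: conditioning the members of a minimizing sequence on \<open>K\<close> keeps it minimizing and
  makes the compactness result available.\<close>

lemma nonneg_energy_minimum_attained:
  fixes w v :: "'a::euclidean_space \<Rightarrow> ennreal"
  assumes w: "\<And>a. open {x. a < w x}" and v: "\<And>a. open {x. a < v x}"
    and K: "compact K" and far: "\<And>x. x \<notin> K \<Longrightarrow> ennreal c \<le> v x"
    and \<rho>\<^sub>0: "\<rho>\<^sub>0 \<in> borel_prob_measures" and low: "2 * nonneg_energy w v \<rho>\<^sub>0 < ennreal c"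
  obtains \<rho> where "\<rho> \<in> borel_prob_measures"
    and "\<And>\<sigma>. \<sigma> \<in> borel_prob_measures \<Longrightarrow> nonneg_energy w v \<rho> \<le> nonneg_energy w v \<sigma>"
proof -
  let ?F = "nonneg_energy w v"
  let ?P = "{\<sigma> \<in> borel_prob_measures. 2 * ?F \<sigma> < ennreal c}"
  \<comment> \<open>Only energies below \<open>c / 2\<close> enter the infimum, since truncation is effective for these alone.\<close>
  define m where "m = Inf (?F ` ?P)"
  obtain u where u: "\<And>n. u n \<in> ?F ` ?P" "u \<longlonglongrightarrow> m"
    using Inf_as_limit[of "?F ` ?P"] \<rho>\<^sub>0 low unfolding m_def by blast
  have "\<exists>\<sigma>. \<sigma> \<in> ?P \<and> u n = ?F \<sigma>" for n using u(1)[of n] by blast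
  then obtain \<sigma> where \<sigma>: "\<And>n. \<sigma> n \<in> ?P" "\<And>n. u n = ?F (\<sigma> n)"
    by metis
  have prob: "prob_space (\<sigma> n)" and sets: "sets (\<sigma> n) = sets borel" for n
    using \<sigma>(1)[of n] by (auto simp: borel_prob_measures_def)
  have K_borel: "K \<in> sets borel" using K by (rule borel_compact)
  define \<tau> where "\<tau> n = uniform_measure (\<sigma> n) K" for n
  note trunc = truncation_decreases_energy[OF prob sets lsc_borel_measurable[OF w]
      lsc_borel_measurable[OF v] K_borel far]
  have pos: "0 < emeasure (\<sigma> n) K" and less: "?F (\<tau> n) \<le> u n" for n
    using trunc(1,2)[of n] \<sigma>[of n] unfolding \<tau>_def by auto
  have \<tau>: "prob_space (\<tau> n)" "sets (\<tau> n) = sets borel" for n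
    using uniform_measure_in_borel_prob_measures[of "\<sigma> n" K] pos \<sigma>(1)[of n]
    unfolding \<tau>_def borel_prob_measures_def by auto
  have \<tau>K: "emeasure (\<tau> n) K = 1" for n
  proof -
    interpret prob_space "\<sigma> n" by (rule prob)
    show ?thesis
      unfolding \<tau>_def using pos[of n] K_borel by (simp add: sets emeasure_uniform_measure less_top[symmetric])
  qed
  obtain r :: "nat \<Rightarrow> nat" and \<Omega> :: "real measure" and X Y where r: "strict_mono r"
      and \<Omega>: "prob_space \<Omega>" "\<And>n. X n \<in> borel_measurable \<Omega>"
      and law: "\<And>n. distr \<Omega> borel (X n) = \<tau> (r n)" and Y: "Y \<in> borel_measurable \<Omega>"
      and conv: "\<And>t. t \<in> space \<Omega> \<Longrightarrow> (\<lambda>n. X n t) \<longlonglongrightarrow> Y t"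
    by (rule compactly_supported_laws_converge_pointwise[OF K \<tau> \<tau>K]) (rule that)
  define \<rho> where "\<rho> = distr \<Omega> borel Y"
  have "?F \<rho> \<le> liminf (\<lambda>n. ?F (\<tau> (r n)))"
    using nonneg_energy_le_liminf[OF \<Omega> Y conv w v] unfolding \<rho>_def law .
  also have "\<dots> \<le> liminf (\<lambda>n. u (r n))"
    by (intro Liminf_mono always_eventually allI less)
  also have "\<dots> = m"
    using LIMSEQ_subseq_LIMSEQ[OF u(2) r] by (intro lim_imp_Liminf) (auto simp: comp_def)
  finally have \<rho>m: "?F \<rho> \<le> m" .
  have m_le: "m \<le> ?F \<mu>" if "\<mu> \<in> ?P" for \<mu> unfolding m_def using that by (intro Inf_lower) blast
  show thesis
  proof (rule that)
    show "\<rho> \<in> borel_prob_measures"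
      unfolding borel_prob_measures_def \<rho>_def using prob_space.prob_space_distr[OF \<Omega>(1) Y] by simp
    fix \<mu> :: "'a measure" assume \<mu>: "\<mu> \<in> borel_prob_measures"
    show "?F \<rho> \<le> ?F \<mu>"
    proof (cases "2 * ?F \<mu> < ennreal c")
      case True
      then show ?thesis using \<rho>m m_le \<mu> by (blast intro: order_trans)
    next
      case False
      \<comment> \<open>A measure of energy at least \<open>c / 2\<close> is beaten already by \<open>\<rho>\<^sub>0\<close>.\<close>
      have "?F \<rho> \<le> ?F \<rho>\<^sub>0" using \<rho>m m_le \<rho>\<^sub>0 low by (blast intro: order_trans)
      moreover have "?F \<rho>\<^sub>0 \<le> ?F \<mu>"
      proof (rule ccontr)
        assume "\<not> ?F \<rho>\<^sub>0 \<le> ?F \<mu>"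
        then have "2 * ?F \<mu> \<le> 2 * ?F \<rho>\<^sub>0" by (intro mult_left_mono) auto
        then show False using False low by auto
      qed
      ultimately show ?thesis by (rule order_trans)
    qed
  qed
qed

section \<open>Reduction to nonnegative kernels\<close>

text \<open>In terms of positive and negative parts \<open>f\<^sup>+ - f\<^sup>- - c = (f - c)\<close>. Splitting also \<open>c\<close> into its parts
  gives an identity between sums of nonnegative terms, which can be integrated; \<open>f\<^sup>-\<close> is bounded by
  the negative part of \<open>c\<close>, so its integral is finite and may be subtracted again.\<close>

lemma ereal_integral_shift:
  assumes "prob_space M" and [measurable]: "f \<in> borel_measurable M" and "\<And>x. ereal c \<le> f x"
  shows "ereal_integral M f = enn2ereal (\<integral>\<^sup>+x. e2ennreal (f x - ereal c) \<partial>M) + ereal c"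
proof -
  interpret prob_space M by fact
  have "e2ennreal (f x) + ennreal (- c) = e2ennreal (f x - ereal c) + e2ennreal (- f x) + ennreal c" for x
  proof (cases "f x")
    case (real r)
    then show ?thesis using assms(3)[of x]
      by (cases "0 \<le> r"; cases "0 \<le> c") (simp_all add: ennreal_neg flip: ennreal_plus)
  qed (use assms(3)[of x] in \<open>auto\<close>)
  then have "(\<integral>\<^sup>+x. e2ennreal (f x) + ennreal (- c) \<partial>M)
      = (\<integral>\<^sup>+x. e2ennreal (f x - ereal c) + e2ennreal (- f x) + ennreal c \<partial>M)"
    by simp
  then have eq: "(\<integral>\<^sup>+x. e2ennreal (f x) \<partial>M) + ennreal (- c)
      = (\<integral>\<^sup>+x. e2ennreal (f x - ereal c) \<partial>M) + (\<integral>\<^sup>+x. e2ennreal (- f x) \<partial>M) + ennreal c"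
    by (simp add: nn_integral_add emeasure_space_1)
  have "(\<integral>\<^sup>+x. e2ennreal (- f x) \<partial>M) \<le> (\<integral>\<^sup>+x. ennreal (- c) \<partial>M)"
    using assms(3) by (intro nn_integral_mono) (metis e2ennreal_ereal e2ennreal_mono ereal_minus_le_minus uminus_ereal.simps(1))
  then have "(\<integral>\<^sup>+x. e2ennreal (- f x) \<partial>M) \<noteq> \<top>"
    by (auto simp: emeasure_space_1 top_unique)
  then show ?thesis
    using eq unfolding ereal_integral_def
    by (cases "\<integral>\<^sup>+x. e2ennreal (f x) \<partial>M"; cases "\<integral>\<^sup>+x. e2ennreal (f x - ereal c) \<partial>M";
        cases "\<integral>\<^sup>+x. e2ennreal (- f x) \<partial>M"; cases "0 \<le> c")
       (auto simp: ennreal_neg simp flip: ennreal_plus)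
qed

text \<open>The total mass is one, so each of the two nested integrals of \<open>W\<close> passes the lower bound \<open>a\<close>
  through unchanged; with the factor one half it contributes \<open>a / 2\<close>.\<close>

lemma energy_eq_nonneg_energy:
  fixes W U :: "'a::euclidean_space \<Rightarrow> ereal"
  assumes "\<rho> \<in> borel_prob_measures"
    and [measurable]: "W \<in> borel_measurable borel" "U \<in> borel_measurable borel"
    and a: "\<And>x. ereal a \<le> W x" and b: "\<And>x. ereal b \<le> U x"
  shows "energy W U \<rho> = enn2ereal (nonneg_energy (\<lambda>x. e2ennreal (W x - ereal a) / 2)
      (\<lambda>x. e2ennreal (U x - ereal b)) \<rho>) + ereal (a / 2 + b)"
proof -
  have prob: "prob_space \<rho>" and sets[measurable_cong]: "sets \<rho> = sets borel"
    using assms(1) by (auto simp: borel_prob_measures_def)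
  interpret prob_space \<rho> by (rule prob)
  define J where "J x = (\<integral>\<^sup>+y. e2ennreal (W (x - y) - ereal a) \<partial>\<rho>)" for x
  have [measurable]: "J \<in> borel_measurable borel" unfolding J_def by measurable
  have inner: "ereal_integral \<rho> (\<lambda>y. W (x - y)) = enn2ereal (J x) + ereal a" for x
    unfolding J_def by (rule ereal_integral_shift[OF prob]) (use a in auto)
  have "ereal_integral \<rho> (\<lambda>x. enn2ereal (J x) + ereal a)
      = enn2ereal (\<integral>\<^sup>+x. e2ennreal (enn2ereal (J x) + ereal a - ereal a) \<partial>\<rho>) + ereal a"
    by (rule ereal_integral_shift[OF prob]) (auto simp: ereal_le_add_self2)
  also have "(\<lambda>x. enn2ereal (J x) + ereal a - ereal a) = (\<lambda>x. enn2ereal (J x))"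
    proof
    show "enn2ereal (J x) + ereal a - ereal a = enn2ereal (J x)" for x by (cases "enn2ereal (J x)") auto
  qed
  finally have outer: "ereal_integral \<rho> (\<lambda>x. ereal_integral \<rho> (\<lambda>y. W (x - y)))
      = enn2ereal (\<integral>\<^sup>+x. J x \<partial>\<rho>) + ereal a" by (simp add: inner)
  have ext: "ereal_integral \<rho> U = enn2ereal (\<integral>\<^sup>+x. e2ennreal (U x - ereal b) \<partial>\<rho>) + ereal b"
    by (rule ereal_integral_shift[OF prob]) (use b in auto)
  have "(\<integral>\<^sup>+x. \<integral>\<^sup>+y. e2ennreal (W (x - y) - ereal a) / 2 \<partial>\<rho> \<partial>\<rho>) = (\<integral>\<^sup>+x. J x / 2 \<partial>\<rho>)"
    unfolding J_def by (subst nn_integral_divide) auto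
  also have "\<dots> = (\<integral>\<^sup>+x. J x \<partial>\<rho>) / 2" by (rule nn_integral_divide) measurable
  finally have half: "(\<integral>\<^sup>+x. \<integral>\<^sup>+y. e2ennreal (W (x - y) - ereal a) / 2 \<partial>\<rho> \<partial>\<rho>) = (\<integral>\<^sup>+x. J x \<partial>\<rho>) / 2" .
  show ?thesis
    unfolding energy_def outer ext nonneg_energy_def half
    by (cases "\<integral>\<^sup>+x. J x \<partial>\<rho>"; cases "\<integral>\<^sup>+x. e2ennreal (U x - ereal b) \<partial>\<rho>")
       (simp_all add: ennreal_divide_numeral ennreal_top_divide field_simps flip: ennreal_plus)
qed

lemma lower_semicontinuous_open:
  assumes "lower_semicontinuous f"
  shows "open {x. t < f x}"
proof (subst open_subopen, intro ballI)
  fix x assume x: "x \<in> {x. t < f x}"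
  then have "\<forall>\<^sub>F y in at x. t < f y"
    using assms unfolding lower_semicontinuous_def le_Liminf_iff by blast
  with x have "\<forall>\<^sub>F y in nhds x. t < f y" by (simp add: eventually_nhds_conv_at)
  then show "\<exists>T. open T \<and> x \<in> T \<and> T \<subseteq> {x. t < f x}" unfolding eventually_nhds by blast
qed

lemma lower_semicontinuous_borel_measurable:
  fixes f :: "'a::topological_space \<Rightarrow> ereal"
  assumes "lower_semicontinuous f"
  shows "f \<in> borel_measurable borel"
  by (rule borel_measurableI_greater) (use lower_semicontinuous_open[OF assms] in simp)

lemma less_e2ennreal_diff_iff:
  assumes "ereal c \<le> y"
  shows "t < e2ennreal (y - ereal c) \<longleftrightarrow> enn2ereal t + ereal c < y"
  using assms by (cases y; cases t) (auto simp: ennreal_less_iff less_top)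

lemma less_half_iff: "t < z / 2 \<longleftrightarrow> 2 * t < (z::ennreal)"
proof (cases z)
  case (real r)
  then have z: "z / 2 = ennreal (r / 2)" by (simp add: ennreal_divide_numeral)
  show ?thesis
  proof (cases t)
    case t: (real q)
    then have "2 * t = ennreal (2 * q)" by (simp add: ennreal_mult)
    then show ?thesis unfolding z using t real by (simp add: ennreal_less_iff field_simps)
  qed (simp add: real z ennreal_mult_top)
next
  case top
  then show ?thesis by (cases t) (auto simp: ennreal_top_divide ennreal_mult_top ennreal_mult_less_top)
qed

text \<open>Were the infimum infinite, \<open>f\<close> would be infinite everywhere and not integrable over a ball.\<close>

lemma locally_integrable_INF_real:
  fixes f :: "'a::euclidean_space \<Rightarrow> ereal"
  assumes "locally_integrable f" "bounded_from_below f"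
  obtains c where "(INF x. f x) = ereal c"
proof -
  obtain k where k: "\<And>x. ereal k \<le> f x" using assms(2) unfolding bounded_from_below_def by blast
  then have "ereal k \<le> (INF x. f x)" by (intro INF_greatest)
  moreover have "(INF x. f x) \<noteq> \<infinity>"
  proof
    assume "(INF x. f x) = \<infinity>"
    then have "f x = \<infinity>" for x by (metis INF_lower UNIV_I ereal_infty_less_eq(1))
    then have "(\<integral>\<^sup>+x\<in>cball 0 1. e2ennreal \<bar>f x\<bar> \<partial>lebesgue) = \<infinity> * emeasure lebesgue (cball (0::'a) 1)"
      by (simp add: nn_integral_cmult_indicator)
    moreover have "emeasure lebesgue (cball (0::'a) 1) \<noteq> 0"
      using content_cball_pos[of 1 "0::'a"] by (auto simp: measure_def)
    ultimately have "(\<integral>\<^sup>+x\<in>cball 0 1. e2ennreal \<bar>f x\<bar> \<partial>lebesgue) = \<infinity>"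
      by (simp add: ennreal_top_mult)
    then show False using assms(1) unfolding locally_integrable_def by (metis compact_cball less_irrefl)
  qed
  ultimately show thesis using that by (cases "INF x. f x") auto
qed

lemma enn2ereal_add_less_iff: "enn2ereal x + ereal k < enn2ereal y + ereal k \<longleftrightarrow> x < y"
  by (cases x; cases y) (auto simp: ennreal_less_iff less_top)

section \<open>Minimizers and their supports\<close>

lemma compact_measure_support:
  fixes \<rho> :: "'a::t2_space measure"
  assumes "compact K" and "emeasure \<rho> (- K) = 0"
  shows "compact (measure_support \<rho>)"
proof -
  have "closed (measure_support \<rho>)"
    unfolding closed_def
  proof (subst open_subopen, intro ballI)
    fix x assume "x \<in> - measure_support \<rho>"
    then obtain V where "open V" "x \<in> V" "emeasure \<rho> V = 0"
      unfolding measure_support_def by (auto simp: zero_less_iff_neq_zero)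
    then show "\<exists>T. open T \<and> x \<in> T \<and> T \<subseteq> - measure_support \<rho>"
      unfolding measure_support_def by (intro exI[of _ V]) force
  qed
  moreover have "measure_support \<rho> \<subseteq> K"
    using assms compact_imp_closed[OF assms(1)] unfolding measure_support_def closed_def by force
  ultimately show ?thesis using assms(1) by (metis compact_Int_closed inf.absorb_iff2)
qed

theorem theorem1p4:
  fixes W U :: "'a::euclidean_space \<Rightarrow> ereal" and U_inf :: ereal
  assumes "\<And>x. W x \<noteq> -\<infinity>" and "\<And>x. U x \<noteq> -\<infinity>" and "U_inf \<noteq> -\<infinity>"
    and "locally_integrable W" and "bounded_from_below W" and "lower_semicontinuous W"
    and "\<And>x. W x = W (- x)"
    and "locally_integrable U" and "bounded_from_below U" and "lower_semicontinuous U"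
    and "(U \<longlongrightarrow> U_inf) at_infinity"
    and "(INF \<rho>\<in>borel_prob_measures. energy W U \<rho>)
           < ereal (1/2) * (U_inf + (INF x. U x) + (INF x. W x))"
  shows "(\<exists>\<rho>. minimizer W U \<rho>) \<and>
         (\<forall>\<rho>. minimizer W U \<rho> \<longrightarrow> compact (measure_support \<rho>))"
proof -
  obtain a where a: "(INF x. W x) = ereal a"
    using locally_integrable_INF_real[OF assms(4,5)] .
  obtain b where b: "(INF x. U x) = ereal b"
    using locally_integrable_INF_real[OF assms(8,9)] .
  have aW: "ereal a \<le> W x" and bU: "ereal b \<le> U x" for x
    unfolding a[symmetric] b[symmetric] by (auto intro: INF_lower)
  define w where "w x = e2ennreal (W x - ereal a) / 2" for x
  define v where "v x = e2ennreal (U x - ereal b)" for x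
  have w: "open {x. t < w x}" for t
    unfolding w_def less_half_iff less_e2ennreal_diff_iff[OF aW]
    by (rule lower_semicontinuous_open[OF assms(6)])
  have v: "open {x. t < v x}" for t
    unfolding v_def less_e2ennreal_diff_iff[OF bU]
    by (rule lower_semicontinuous_open[OF assms(10)])
  have energy: "energy W U \<rho> = enn2ereal (nonneg_energy w v \<rho>) + ereal (a / 2 + b)"
    if "\<rho> \<in> borel_prob_measures" for \<rho>
    using energy_eq_nonneg_energy[OF that lower_semicontinuous_borel_measurable[OF assms(6)]
      lower_semicontinuous_borel_measurable[OF assms(10)] aW bU]
    unfolding w_def v_def .
  have energy_less: "energy W U \<rho> < energy W U \<sigma> \<longleftrightarrow> nonneg_energy w v \<rho> < nonneg_energy w v \<sigma>"
    if "\<rho> \<in> borel_prob_measures" "\<sigma> \<in> borel_prob_measures" for \<rho> \<sigma>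
    unfolding energy[OF that(1)] energy[OF that(2)] by (rule enn2ereal_add_less_iff)
  obtain \<rho>\<^sub>0 where \<rho>\<^sub>0: "\<rho>\<^sub>0 \<in> borel_prob_measures"
      and less: "energy W U \<rho>\<^sub>0 < ereal (1/2) * (U_inf + ereal b + ereal a)"
    using assms(12) unfolding a b by (auto simp: INF_less_iff)
  have "nonneg_energy w v \<rho>\<^sub>0 \<noteq> \<top>" using less unfolding energy[OF \<rho>\<^sub>0] by auto
  then obtain s where s: "nonneg_energy w v \<rho>\<^sub>0 = ennreal s" "0 \<le> s"
    by (cases "nonneg_energy w v \<rho>\<^sub>0") auto
  \<comment> \<open>After normalization the hypothesis reads \<open>2 * s < U_inf - b\<close>; choose \<open>c\<close> strictly between.\<close>
  obtain c where c: "2 * s < c" "ereal (b + c) < U_inf"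
  proof (cases U_inf)
    case (real l)
    have "s + (a / 2 + b) < 1 / 2 * (l + b + a)"
      using less unfolding energy[OF \<rho>\<^sub>0] s real using s(2) by simp
    then have "2 * s < l - b" by (simp add: field_simps)
    then show thesis using that[of "(2 * s + (l - b)) / 2"] real by (simp add: field_simps)
  next
    case PInf
    then show thesis using that[of "2 * s + 1"] by simp
  qed (use assms(3) in simp)
  have low: "2 * nonneg_energy w v \<rho>\<^sub>0 < ennreal c"
    using c(1) s by (simp add: ennreal_less_iff flip: ennreal_mult ennreal_numeral)
  obtain R where R: "\<And>x. R \<le> norm x \<Longrightarrow> ereal (b + c) < U x"
    using order_tendstoD(1)[OF assms(11) c(2)] unfolding eventually_at_infinity by blast
  define K where "K = cball (0::'a) R"
  have K: "compact K" "K \<in> sets borel" unfolding K_def by auto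
  have far: "ennreal c \<le> v x" if "x \<notin> K" for x
  proof -
    have "ereal c \<le> U x - ereal b"
      using R[of x] that unfolding K_def by (cases "U x") (auto simp: algebra_simps)
    then show ?thesis unfolding v_def using e2ennreal_mono by fastforce
  qed
  obtain \<rho> where \<rho>: "\<rho> \<in> borel_prob_measures"
      "\<And>\<sigma>. \<sigma> \<in> borel_prob_measures \<Longrightarrow> nonneg_energy w v \<rho> \<le> nonneg_energy w v \<sigma>"
    using nonneg_energy_minimum_attained[OF w v K(1) far \<rho>\<^sub>0 low] by blast
  have "minimizer W U \<rho>"
    unfolding minimizer_def is_arg_min_def using \<rho> energy_less by (metis not_less)
  moreover have "compact (measure_support \<sigma>)" if "minimizer W U \<sigma>" for \<sigma>
  proof -
    have \<sigma>: "\<sigma> \<in> borel_prob_measures"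
      and min: "\<And>\<tau>. \<tau> \<in> borel_prob_measures \<Longrightarrow> nonneg_energy w v \<sigma> \<le> nonneg_energy w v \<tau>"
      using that energy_less unfolding minimizer_def is_arg_min_def by (auto simp: not_less[symmetric])
    have prob: "prob_space \<sigma>" and sets: "sets \<sigma> = sets borel"
      using \<sigma> by (auto simp: borel_prob_measures_def)
    have "2 * nonneg_energy w v \<sigma> < ennreal c"
      using mult_left_mono[OF min[OF \<rho>\<^sub>0], of 2] low by (simp add: le_less_trans)
    note trunc = truncation_decreases_energy[OF prob sets lsc_borel_measurable[OF w]
        lsc_borel_measurable[OF v] K(2) far this]
    \<comment> \<open>Otherwise conditioning on \<open>K\<close> would strictly decrease the energy of a minimizer.\<close>
    have "emeasure \<sigma> K = 1"
      using trunc(1,3) min[OF uniform_measure_in_borel_prob_measures[OF \<sigma>]] by (auto simp: not_less[symmetric])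
    then have "emeasure \<sigma> (- K) = 0"
      using prob_space.emeasure_space_1[OF prob] K(2) sets sets_eq_imp_space_eq[OF sets]
      by (subst Compl_eq_Diff_UNIV) (simp add: emeasure_Diff[of \<sigma> K UNIV])
    then show ?thesis by (rule compact_measure_support[OF K(1)])
  qed
  ultimately show ?thesis by blast
qed

end
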